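(* Let $a,\lambda,\eta>0$ and let $x^{*}\in\mathbb{R}^n$ be an optimal solution (global minimizer) of the problem $(FP_{a,\lambda,\eta})$. If $\lambda>\frac1T\|\beta e_T\|_2^2+\eta\|b\|_2^2$, then $$\|x^{*}\|_\infty\le\frac{\frac1T\|\beta e_T\|_2^2+\eta\|b\|_2^2}{a\left(\lambda-\left(\frac1T\|\beta e_T\|_2^2+\eta\|b\|_2^2\right)\right)}.$$
   Context: Let $T,n$ be positive integers, $r_1,\dots,r_T\in\mathbb{R}^n$ the vectors of asset returns, $R=(r_1,\dots,r_T)^\top\in\mathbb{R}^{T\times n}$, $\mu\in\mathbb{R}^n$ the (given) mean return vector, $\beta\in\mathbb{R}$, $e_m\in\mathbb{R}^m$ the vector of all ones, $A=(\mu,e_n)^\top\in\mathbb{R}^{2\times n}$, $b=(\beta,1)^\top\in\mathbb{R}^2$. For $a>0$ let $\rho_a(t)=\frac{a|t|}{a|t|+1}$ for $t\in\mathbb{R}$ and $P_a(x)=\sum_i\rho_a(x_i)$. For $\lambda,\eta>0$ the problem $(FP_{a,\lambda,\eta})$ is the minimization over $x\in\mathbb{R}^n$ of $$\frac1T\|Rx-\beta e_T\|_2^2+\lambda P_a(x)+\eta\|Ax-b\|_2^2 .$$ *)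

theory Defs
  imports "HOL-Analysis.Analysis"
begin

text \<open>
  The finite index types \<open>'t\<close> and \<open>'n\<close> stand for \<open>{1..T}\<close> and \<open>{1..n}\<close>, so
  \<open>T = CARD('t)\<close> and \<open>n = CARD('n)\<close> are arbitrary positive integers. The norm on
  \<open>real ^ 'm\<close> is the Euclidean norm.
\<close>

definition ones :: "real ^ 'm::finite" where
  "ones = (\<chi> i. 1)"

definition return_matrix :: "('t::finite \<Rightarrow> real ^ 'n::finite) \<Rightarrow> real ^ 'n ^ 't" where
  "return_matrix r = (\<chi> t. r t)"

definition constraint_matrix :: "real ^ 'n::finite \<Rightarrow> real ^ 'n ^ 2" where
  "constraint_matrix \<mu> = vector [\<mu>, ones]"

definition constraint_rhs :: "real \<Rightarrow> real ^ 2" where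
  "constraint_rhs \<beta> = vector [\<beta>, 1]"

definition rho :: "real \<Rightarrow> real \<Rightarrow> real" where
  "rho a t = a * \<bar>t\<bar> / (a * \<bar>t\<bar> + 1)"

definition fraction_penalty :: "real \<Rightarrow> real ^ 'n::finite \<Rightarrow> real" where
  "fraction_penalty a x = (\<Sum>i\<in>UNIV. rho a (x $ i))"

definition FP_objective ::
  "('t::finite \<Rightarrow> real ^ 'n::finite) \<Rightarrow> real ^ 'n \<Rightarrow> real \<Rightarrow>
    real \<Rightarrow> real \<Rightarrow> real \<Rightarrow> real ^ 'n \<Rightarrow> real" where
  "FP_objective r \<mu> \<beta> a l \<eta> x =
     1 / real CARD('t) * (norm (return_matrix r *v x - \<beta> *\<^sub>R ones))\<^sup>2
     + l * fraction_penalty a x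
     + \<eta> * (norm (constraint_matrix \<mu> *v x - constraint_rhs \<beta>))\<^sup>2"

definition FP_optimal ::
  "('t::finite \<Rightarrow> real ^ 'n::finite) \<Rightarrow> real ^ 'n \<Rightarrow> real \<Rightarrow>
    real \<Rightarrow> real \<Rightarrow> real \<Rightarrow> real ^ 'n \<Rightarrow> bool" where
  "FP_optimal r \<mu> \<beta> a l \<eta> x \<longleftrightarrow> is_arg_min (FP_objective r \<mu> \<beta> a l \<eta>) (\<lambda>_. True) x"

end

theory Submission
  imports Defs
begin

text \<open>Comparing \<open>x\<close> with the origin, where the objective equals the constant \<open>C\<close> of the bound,
gives \<open>l * rho a (x $ i) \<le> C\<close> for each \<open>i\<close>; since \<open>C < l\<close>, this can be solved for \<open>\<bar>x $ i\<bar>\<close>.\<close>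

lemma rho_nonneg: "a > 0 \<Longrightarrow> 0 \<le> rho a t"
  by (simp add: rho_def)

lemma fraction_penalty_zero [simp]: "fraction_penalty a 0 = 0"
  by (simp add: fraction_penalty_def rho_def)

lemma rho_le_fraction_penalty:
  assumes "a > 0"
  shows "rho a (x $ i) \<le> fraction_penalty a x"
  unfolding fraction_penalty_def
  by (rule member_le_sum) (use assms in \<open>auto intro: rho_nonneg\<close>)

text \<open>At the origin the penalty vanishes and the two residuals become
  \<open>- \<beta> *\<^sub>R ones\<close> and \<open>- constraint_rhs \<beta>\<close>, whose signs
  the norm ignores.\<close>

lemma FP_objective_zero:
  fixes r :: "'t::finite \<Rightarrow> real ^ 'n::finite"
  shows "FP_objective r \<mu> \<beta> a l \<eta> 0 =
    1 / real CARD('t) * (norm (\<beta> *\<^sub>R ones :: real ^ 't))\<^sup>2 + \<eta> * (norm (constraint_rhs \<beta>))\<^sup>2"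
  by (simp add: FP_objective_def)

lemma fraction_penalty_le_FP_objective:
  assumes "\<eta> \<ge> 0"
  shows "l * fraction_penalty a x \<le> FP_objective r \<mu> \<beta> a l \<eta> x"
  using assms by (simp add: FP_objective_def)

text \<open>Clearing the positive denominator of \<open>rho\<close> makes the hypothesis linear in
  \<open>\<bar>t\<bar>\<close>. Collecting terms leaves the coefficient \<open>a * (l - c)\<close>,
  and \<open>c < l\<close> makes it positive, so dividing by it keeps the direction of the
  inequality.\<close>

lemma abs_le_if_rho_le:
  assumes "a > 0" and "c < l" and "l * rho a t \<le> c"
  shows "\<bar>t\<bar> \<le> c / (a * (l - c))"
proof -
  have "a * \<bar>t\<bar> + 1 > 0"
    using assms(1) by (simp add: add_nonneg_pos)
  then have "l * (a * \<bar>t\<bar>) \<le> c * (a * \<bar>t\<bar> + 1)"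
    using assms(3) by (simp add: rho_def pos_divide_le_eq)
  then have "\<bar>t\<bar> * (a * (l - c)) \<le> c"
    by (simp add: algebra_simps)
  then show ?thesis
    using assms(1,2) by (simp add: pos_le_divide_eq)
qed

theorem theorem3:
  fixes r :: "'t::finite \<Rightarrow> real ^ 'n::finite"
    and \<mu> x :: "real ^ 'n"
    and \<beta> a l \<eta> :: real
  assumes "a > 0" and "l > 0" and "\<eta> > 0"
    and "FP_optimal r \<mu> \<beta> a l \<eta> x"
    and "l > 1 / real CARD('t) * (norm (\<beta> *\<^sub>R ones :: real ^ 't))\<^sup>2
             + \<eta> * (norm (constraint_rhs \<beta>))\<^sup>2"
  shows "infnorm x \<le>
    (1 / real CARD('t) * (norm (\<beta> *\<^sub>R ones :: real ^ 't))\<^sup>2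
       + \<eta> * (norm (constraint_rhs \<beta>))\<^sup>2)
    / (a * (l - (1 / real CARD('t) * (norm (\<beta> *\<^sub>R ones :: real ^ 't))\<^sup>2
                 + \<eta> * (norm (constraint_rhs \<beta>))\<^sup>2)))"
proof -
  define C where "C = 1 / real CARD('t) * (norm (\<beta> *\<^sub>R ones :: real ^ 't))\<^sup>2
    + \<eta> * (norm (constraint_rhs \<beta>))\<^sup>2"
  have "FP_objective r \<mu> \<beta> a l \<eta> x \<le> FP_objective r \<mu> \<beta> a l \<eta> 0"
    using assms(4) by (simp add: FP_optimal_def is_arg_min_linorder)
  then have "l * fraction_penalty a x \<le> C"
    using fraction_penalty_le_FP_objective[of \<eta> l a x r \<mu> \<beta>] assms(3)
    by (simp add: FP_objective_zero C_def)
  \<comment> \<open>A single summand is at most the whole penalty because all summands are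
    nonnegative.\<close>
  then have "l * rho a (x $ i) \<le> C" for i
    using mult_left_mono[OF rho_le_fraction_penalty[OF assms(1), of x i], of l] assms(2)
    by linarith
  then have "\<bar>x $ i\<bar> \<le> C / (a * (l - C))" for i
    using abs_le_if_rho_le assms(1,5) unfolding C_def by blast
  \<comment> \<open>The bound is uniform in \<open>i\<close>, so it passes to the supremum of the
    \<open>\<bar>x $ i\<bar>\<close>, taken over a nonempty index set.\<close>
  then have "infnorm x \<le> C / (a * (l - C))"
    by (auto simp: infnorm_cart intro!: cSup_least)
  then show ?thesis
    by (simp only: C_def)
qed

end
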